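(* The Casimir class of the Racah algebra $\Re$ is invariant under the $D_6$-action on $\Re$.
   Context: $\mathbb F$ is a field with $\operatorname{char}\mathbb F\neq 2$. All algebras are unital and associative, and a subalgebra has the same unit as the parent algebra. Write $[x,y]=xy-yx$ and $\{x,y\}=xy+yx$. The Racah algebra $\Re$ is the $\mathbb F$-algebra defined by generators $A,B,C,D$ and the relations $[A,B]=[B,C]=[C,A]=2D$ together with the relations asserting that each of the elements $$\alpha=[A,D]+AC-BA,\qquad \beta=[B,D]+BA-CB,\qquad \gamma=[C,D]+CB-AC$$ is central in $\Re$. Set $\delta=A+B+C$. Let $\mathfrak C$ denote the $\mathbb F$-subalgebra of $\Re$ generated by $\alpha,\beta,\gamma,\delta$. The Casimir class of $\Re$ is the coset $$D^2+A^2+B^2+\frac{(\delta+2)\{A,B\}-\{A^2,B\}-\{A,B^2\}}{2}+A(\beta-\delta)-B(\delta+\alpha)+\mathfrak C$$ of $\mathfrak C$ in $\Re$. $D_6$ is the dihedral group with generators $\sigma,\tau$ and relations $\sigma^2=1$, $\tau^6=1$, $(\sigma\tau)^2=1$. The $D_6$-action on $\Re$ is the unique one for which $\sigma$ and $\tau$ act as $\mathbb F$-algebra antiautomorphisms with: $\sigma$ sends $A,B,C,D,\alpha,\beta,\gamma,\delta$ to $B,A,C,D,-\beta,-\alpha,-\gamma,\delta$ respectively, and $\tau$ sends $A,B,C,D,\alpha,\beta,\gamma,\delta$ to $B,C,A,-D,\beta,\gamma,\alpha,\delta$ respectively. *)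

theory Defs
  imports Complex_Main "HOL-Algebra.Group_Action" "HOL-Library.Numeral_Type"
begin

section \<open>The Racah algebra\<close>

text \<open>The algebra is built as the quotient of the unital algebra expressions in four generators
  by the smallest congruence that contains the axioms of unital associative algebras and the
  defining relations. Lemma \<open>racah_universal\<close> below confirms that the result has the universal
  property of the algebra presented by these generators and relations.\<close>

datatype racah_gen = GA | GB | GC | GD

datatype 'a racah_expr =
    Gen racah_gen
  | Const 'a
  | Add "'a racah_expr" "'a racah_expr"
  | Mult "'a racah_expr" "'a racah_expr"

instantiation racah_expr :: ("{uminus, one}") "{plus, times, minus}"
begin
definition "x + y = Add x y"
definition "x * y = Mult x y"
definition "x - y = Add x (Mult (Const (- 1)) y)" for x y :: "'a racah_expr"
instance ..
end

abbreviation "eA \<equiv> Gen GA"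
abbreviation "eB \<equiv> Gen GB"
abbreviation "eC \<equiv> Gen GC"
abbreviation "eD \<equiv> Gen GD"

inductive racah_eq :: "'a::field racah_expr \<Rightarrow> 'a racah_expr \<Rightarrow> bool"  (infix "\<approx>R" 50) where
  R_refl: "x \<approx>R x"
| R_sym: "x \<approx>R y \<Longrightarrow> y \<approx>R x"
| R_trans: "x \<approx>R y \<Longrightarrow> y \<approx>R z \<Longrightarrow> x \<approx>R z"
| R_add_cong: "x \<approx>R x' \<Longrightarrow> y \<approx>R y' \<Longrightarrow> x + y \<approx>R x' + y'"
| R_mult_cong: "x \<approx>R x' \<Longrightarrow> y \<approx>R y' \<Longrightarrow> x * y \<approx>R x' * y'"
| R_add_assoc: "x + y + z \<approx>R x + (y + z)"
| R_add_comm: "x + y \<approx>R y + x"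
| R_add_zero: "Const 0 + x \<approx>R x"
| R_mult_assoc: "x * y * z \<approx>R x * (y * z)"
| R_mult_one: "Const 1 * x \<approx>R x"
| R_mult_zero: "Const 0 * x \<approx>R Const 0"
| R_distrib_left: "x * (y + z) \<approx>R x * y + x * z"
| R_distrib_right: "(x + y) * z \<approx>R x * z + y * z"
| R_const_add: "Const (k + l) \<approx>R Const k + Const l"
| R_const_mult: "Const (k * l) \<approx>R Const k * Const l"
| R_const_central: "Const k * x \<approx>R x * Const k"
| rel_AB: "eA * eB - eB * eA \<approx>R Const 2 * eD"
| rel_BC: "eB * eC - eC * eB \<approx>R Const 2 * eD"
| rel_CA: "eC * eA - eA * eC \<approx>R Const 2 * eD"
| rel_alpha: "((eA * eD - eD * eA) + eA * eC - eB * eA) * x \<approx>R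
              x * ((eA * eD - eD * eA) + eA * eC - eB * eA)"
| rel_beta:  "((eB * eD - eD * eB) + eB * eA - eC * eB) * x \<approx>R
              x * ((eB * eD - eD * eB) + eB * eA - eC * eB)"
| rel_gamma: "((eC * eD - eD * eC) + eC * eB - eA * eC) * x \<approx>R
              x * ((eC * eD - eD * eC) + eC * eB - eA * eC)"

text \<open>Evaluation with respect to an arbitrary product \<open>m\<close>, so that it covers both
  homomorphisms and antihomomorphisms.\<close>

primrec racah_eval ::
    "('a \<Rightarrow> 'b) \<Rightarrow> ('b \<Rightarrow> 'b \<Rightarrow> 'b) \<Rightarrow> (racah_gen \<Rightarrow> 'b) \<Rightarrow> 'a racah_expr \<Rightarrow> 'b::ring_1" where
  "racah_eval \<eta> m s (Gen g) = s g"
| "racah_eval \<eta> m s (Const k) = \<eta> k"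
| "racah_eval \<eta> m s (Add x y) = racah_eval \<eta> m s x + racah_eval \<eta> m s y"
| "racah_eval \<eta> m s (Mult x y) = m (racah_eval \<eta> m s x) (racah_eval \<eta> m s y)"

locale racah_model =
  fixes \<eta> :: "'a::field \<Rightarrow> 'b::ring_1" and m :: "'b \<Rightarrow> 'b \<Rightarrow> 'b" and a b c d :: 'b
  assumes m_assoc: "m (m x y) z = m x (m y z)"
    and m_left: "m x (y + z) = m x y + m x z"
    and m_right: "m (x + y) z = m x z + m y z"
    and m_one: "m 1 x = x"
    and hom_add: "\<eta> (k + l) = \<eta> k + \<eta> l"
    and hom_mult: "\<eta> (k * l) = m (\<eta> k) (\<eta> l)"
    and hom_one: "\<eta> 1 = 1"
    and hom_central: "m (\<eta> k) x = m x (\<eta> k)"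
    and model_AB: "m a b - m b a = d + d"
    and model_BC: "m b c - m c b = d + d"
    and model_CA: "m c a - m a c = d + d"
    and model_alpha: "m ((m a d - m d a) + m a c - m b a) x = m x ((m a d - m d a) + m a c - m b a)"
    and model_beta: "m ((m b d - m d b) + m b a - m c b) x = m x ((m b d - m d b) + m b a - m c b)"
    and model_gamma: "m ((m c d - m d c) + m c b - m a c) x = m x ((m c d - m d c) + m c b - m a c)"
begin

definition ev :: "'a racah_expr \<Rightarrow> 'b" where
  "ev = racah_eval \<eta> m (\<lambda>g. case g of GA \<Rightarrow> a | GB \<Rightarrow> b | GC \<Rightarrow> c | GD \<Rightarrow> d)"

lemma hom_zero: "\<eta> 0 = 0"
  using hom_add[of 0 0] by simp

lemma m_zero: "m 0 x = 0"
  using m_right[of 0 0 x] by simp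

lemma m_minus: "m (- 1) x = - x"
  using m_right[of 1 "- 1" x] by (simp add: m_zero m_one eq_neg_iff_add_eq_0 add.commute)

lemma hom_minus_one: "\<eta> (- 1) = - 1"
  using hom_add[of 1 "- 1"] by (simp add: hom_zero hom_one eq_neg_iff_add_eq_0 add.commute)

lemma m_two: "m (\<eta> 2) x = x + x"
  using hom_add[of 1 1] by (simp only: m_right m_one hom_one one_add_one[symmetric])

lemma ev_simps:
  "ev (Const k) = \<eta> k" "ev (x + y) = ev x + ev y" "ev (x * y) = m (ev x) (ev y)"
  "ev (x - y) = ev x - ev y" "ev eA = a" "ev eB = b" "ev eC = c" "ev eD = d"
  by (simp_all add: ev_def plus_racah_expr_def times_racah_expr_def minus_racah_expr_def
      hom_minus_one m_minus)

lemma ev_cong: "x \<approx>R y \<Longrightarrow> ev x = ev y"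
  by (induction rule: racah_eq.induct, unfold ev_simps hom_zero hom_one m_two)
    (rule refl add.assoc add.commute add_0_left m_assoc m_one m_zero m_left m_right hom_add
       hom_mult hom_central model_AB model_BC model_CA model_alpha model_beta model_gamma
     | erule sym | erule (1) trans | simp only:)+

end

quotient_type (overloaded) 'a racah = "'a::field racah_expr" / "racah_eq"
  by (intro equivpI reflpI sympI transpI) (auto intro: R_refl R_sym R_trans)

instantiation racah :: (field) ring_1
begin

lift_definition zero_racah :: "'a racah" is "Const 0" .
lift_definition one_racah :: "'a racah" is "Const 1" .
lift_definition plus_racah :: "'a racah \<Rightarrow> 'a racah \<Rightarrow> 'a racah" is "(+)"
  by (rule R_add_cong)
lift_definition times_racah :: "'a racah \<Rightarrow> 'a racah \<Rightarrow> 'a racah" is "(*)"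
  by (rule R_mult_cong)
lift_definition uminus_racah :: "'a racah \<Rightarrow> 'a racah" is "\<lambda>x. Const (- 1) * x"
  by (rule R_mult_cong[OF R_refl])
lift_definition minus_racah :: "'a racah \<Rightarrow> 'a racah \<Rightarrow> 'a racah" is "(-)"
  unfolding minus_racah_expr_def plus_racah_expr_def[symmetric] times_racah_expr_def[symmetric]
  by (intro R_add_cong R_mult_cong R_refl)

instance
proof
  fix x y z :: "'a racah"
  show "x + y + z = x + (y + z)" by transfer (rule R_add_assoc)
  show "x + y = y + x" by transfer (rule R_add_comm)
  show "0 + x = x" by transfer (rule R_add_zero)
  show "x * y * z = x * (y * z)" by transfer (rule R_mult_assoc)
  show "1 * x = x" by transfer (rule R_mult_one)
  show "x * 1 = x"
    by transfer (rule R_trans[OF R_sym[OF R_const_central] R_mult_one])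
  show "(x + y) * z = x * z + y * z" by transfer (rule R_distrib_right)
  show "x * (y + z) = x * y + x * z" by transfer (rule R_distrib_left)
  show "x - y = x + - y"
    by transfer (simp add: minus_racah_expr_def plus_racah_expr_def times_racah_expr_def
        R_refl)
  show "- x + x = 0"
  proof transfer
    fix x :: "'a racah_expr"
    have "Const (- 1) * x + x \<approx>R Const (- 1) * x + Const 1 * x"
      by (intro R_add_cong R_refl R_sym[OF R_mult_one])
    moreover have "\<dots> \<approx>R (Const (- 1) + Const 1) * x"
      by (rule R_sym[OF R_distrib_right])
    moreover have "\<dots> \<approx>R Const (- 1 + 1) * x"
      by (intro R_mult_cong R_refl R_sym[OF R_const_add])
    moreover have "\<dots> \<approx>R Const 0" by (simp add: R_mult_zero)
    ultimately show "Const (- 1) * x + x \<approx>R Const 0" by (blast intro: R_trans)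
  qed
  show "(0 :: 'a racah) \<noteq> 1"
  proof transfer
    interpret racah_model "\<lambda>k::'a. k" "(*)" 0 0 0 0
      by unfold_locales (simp_all add: algebra_simps)
    show "\<not> (Const 0 :: 'a racah_expr) \<approx>R Const 1"
      using ev_cong[of "Const 0" "Const 1"] by (auto simp: ev_simps)
  qed
qed

end

lift_definition racah_const :: "'a::field \<Rightarrow> 'a racah" is Const .
lift_definition racah_A :: "'a::field racah" is eA .
lift_definition racah_B :: "'a::field racah" is eB .
lift_definition racah_C :: "'a::field racah" is eC .
lift_definition racah_D :: "'a::field racah" is eD .

definition racah_scale :: "'a::field \<Rightarrow> 'a racah \<Rightarrow> 'a racah" where
  "racah_scale k x = racah_const k * x"

definition racah_alpha :: "'a::field racah" where
  "racah_alpha = (racah_A * racah_D - racah_D * racah_A) + racah_A * racah_C - racah_B * racah_A"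

definition racah_beta :: "'a::field racah" where
  "racah_beta = (racah_B * racah_D - racah_D * racah_B) + racah_B * racah_A - racah_C * racah_B"

definition racah_gamma :: "'a::field racah" where
  "racah_gamma = (racah_C * racah_D - racah_D * racah_C) + racah_C * racah_B - racah_A * racah_C"

definition racah_delta :: "'a::field racah" where
  "racah_delta = racah_A + racah_B + racah_C"

lemma racah_const_add: "racah_const (k + l) = racah_const k + racah_const l"
  by transfer (rule R_const_add)

lemma racah_const_mult: "racah_const (k * l) = racah_const k * racah_const l"
  by transfer (rule R_const_mult)

lemma racah_const_one: "racah_const 1 = 1"
  by transfer (rule R_refl)

lemma racah_const_central: "racah_const k * x = x * racah_const k"
  by transfer (rule R_const_central)

lemma racah_const_two: "racah_const 2 = 2"
  using racah_const_add[of 1 1] by (simp add: racah_const_one)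

lemma racah_AB: "racah_A * racah_B - racah_B * racah_A = 2 * racah_D"
  unfolding racah_const_two[symmetric] by transfer (rule rel_AB)

lemma racah_BC: "racah_B * racah_C - racah_C * racah_B = 2 * racah_D"
  unfolding racah_const_two[symmetric] by transfer (rule rel_BC)

lemma racah_CA: "racah_C * racah_A - racah_A * racah_C = 2 * racah_D"
  unfolding racah_const_two[symmetric] by transfer (rule rel_CA)

lemma racah_alpha_central: "racah_alpha * x = x * racah_alpha"
  unfolding racah_alpha_def by transfer (rule rel_alpha)

lemma racah_beta_central: "racah_beta * x = x * racah_beta"
  unfolding racah_beta_def by transfer (rule rel_beta)

lemma racah_gamma_central: "racah_gamma * x = x * racah_gamma"
  unfolding racah_gamma_def by transfer (rule rel_gamma)

lemma racah_induct [case_names const A B C D add mult]: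
  assumes const: "\<And>k. P (racah_const k)"
    and gens: "P racah_A" "P racah_B" "P racah_C" "P racah_D"
    and add: "\<And>x y. P x \<Longrightarrow> P y \<Longrightarrow> P (x + y)"
    and mult: "\<And>x y. P x \<Longrightarrow> P y \<Longrightarrow> P (x * y)"
  shows "P (x :: 'a::field racah)"
proof -
  have "P (abs_racah e)" for e
  proof (induction e)
    case (Gen g) then show ?case
      by (cases g) (simp_all add: gens[unfolded racah_A.abs_eq racah_B.abs_eq racah_C.abs_eq
            racah_D.abs_eq])
  next
    case (Const k) then show ?case using const[of k] by (simp add: racah_const.abs_eq)
  next
    case (Add x y) then show ?case
      using add by (simp flip: plus_racah_expr_def plus_racah.abs_eq)
  next
    case (Mult x y) then show ?case
      using mult by (simp flip: times_racah_expr_def times_racah.abs_eq)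
  qed
  then show ?thesis by (metis Quotient3_abs_rep[OF Quotient3_racah])
qed

text \<open>The product is a parameter here; with the reversed product this gives antihomomorphisms.\<close>

lemma (in racah_model) racah_extension:
  "\<exists>!h. (\<forall>x y. h (x + y) = h x + h y) \<and> (\<forall>x y. h (x * y) = m (h x) (h y)) \<and>
        (\<forall>k. h (racah_const k) = \<eta> k) \<and>
        h racah_A = a \<and> h racah_B = b \<and> h racah_C = c \<and> h racah_D = d"
proof (rule ex_ex1I)
  define h where "h x = ev (rep_racah x)" for x
  have h: "h (abs_racah e) = ev e" for e
    unfolding h_def
    by (rule ev_cong) (metis Quotient3_racah Quotient3_rep_abs R_refl)
  have surj: "\<exists>e. x = abs_racah e" for x :: "'a racah"
    by (metis Quotient3_abs_rep[OF Quotient3_racah])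
  have 1: "h (x + y) = h x + h y" for x y
    using surj[of x] surj[of y] by (auto simp: plus_racah.abs_eq h ev_simps)
  have 2: "h (x * y) = m (h x) (h y)" for x y
    using surj[of x] surj[of y] by (auto simp: times_racah.abs_eq h ev_simps)
  have 3: "h (racah_const k) = \<eta> k" for k
    by (simp add: racah_const.abs_eq h ev_simps)
  have 4: "h racah_A = a" "h racah_B = b" "h racah_C = c" "h racah_D = d"
    by (simp_all add: racah_A.abs_eq racah_B.abs_eq racah_C.abs_eq racah_D.abs_eq h ev_simps)
  from 1 2 3 4
  show "\<exists>h. (\<forall>x y. h (x + y) = h x + h y) \<and> (\<forall>x y. h (x * y) = m (h x) (h y)) \<and>
        (\<forall>k. h (racah_const k) = \<eta> k) \<and>
        h racah_A = a \<and> h racah_B = b \<and> h racah_C = c \<and> h racah_D = d"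
    by blast
next
  fix h h' :: "'a racah \<Rightarrow> 'b"
  assume hs: "(\<forall>x y. h (x + y) = h x + h y) \<and> (\<forall>x y. h (x * y) = m (h x) (h y)) \<and>
        (\<forall>k. h (racah_const k) = \<eta> k) \<and>
        h racah_A = a \<and> h racah_B = b \<and> h racah_C = c \<and> h racah_D = d"
    "(\<forall>x y. h' (x + y) = h' x + h' y) \<and> (\<forall>x y. h' (x * y) = m (h' x) (h' y)) \<and>
        (\<forall>k. h' (racah_const k) = \<eta> k) \<and>
        h' racah_A = a \<and> h' racah_B = b \<and> h' racah_C = c \<and> h' racah_D = d"
  have "h x = h' x" for x
    by (induction x rule: racah_induct) (simp_all add: hs)
  then show "h = h'" by blast
qed

lemma racah_universal:
  fixes \<eta> :: "'a::field \<Rightarrow> 'b::ring_1" and a b c d :: 'b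
  assumes "\<And>k l. \<eta> (k + l) = \<eta> k + \<eta> l" "\<And>k l. \<eta> (k * l) = \<eta> k * \<eta> l" "\<eta> 1 = 1"
    and "\<And>k x. \<eta> k * x = x * \<eta> k"
    and "a * b - b * a = 2 * d" "b * c - c * b = 2 * d" "c * a - a * c = 2 * d"
    and "\<And>x. ((a * d - d * a) + a * c - b * a) * x = x * ((a * d - d * a) + a * c - b * a)"
    and "\<And>x. ((b * d - d * b) + b * a - c * b) * x = x * ((b * d - d * b) + b * a - c * b)"
    and "\<And>x. ((c * d - d * c) + c * b - a * c) * x = x * ((c * d - d * c) + c * b - a * c)"
  shows "\<exists>!h. (\<forall>x y. h (x + y) = h x + h y) \<and> (\<forall>x y. h (x * y) = h x * h y) \<and>
        (\<forall>k. h (racah_const k) = \<eta> k) \<and>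
        h racah_A = a \<and> h racah_B = b \<and> h racah_C = c \<and> h racah_D = d"
proof -
  interpret racah_model \<eta> "(*)" a b c d
    by unfold_locales (rule mult.assoc distrib_left distrib_right mult_1_left
        assms(5-7)[unfolded mult_2] assms)+
  show ?thesis by (rule racah_extension)
qed

interpretation racah: vector_space racah_scale
  by unfold_locales
    (simp_all add: racah_scale_def racah_const_add racah_const_mult racah_const_one algebra_simps)


section \<open>Subalgebras and the Casimir class\<close>

definition racah_subalgebra :: "'a::field racah set \<Rightarrow> bool" where
  "racah_subalgebra S \<longleftrightarrow> racah.subspace S \<and> 1 \<in> S \<and> (\<forall>x\<in>S. \<forall>y\<in>S. x * y \<in> S)"

definition racah_frakC :: "'a::field racah set" where
  "racah_frakC = racah_subalgebra hull {racah_alpha, racah_beta, racah_gamma, racah_delta}"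

lemma racah_subalgebra_frakC: "racah_subalgebra racah_frakC"
  unfolding racah_frakC_def
  by (rule hull_in) (auto simp: racah_subalgebra_def racah.subspace_def)

definition anticommutator :: "'b::ring \<Rightarrow> 'b \<Rightarrow> 'b"
  where "anticommutator x y = x * y + y * x"

definition racah_Omega :: "'a::field racah" where
  "racah_Omega =
     racah_D\<^sup>2 + racah_A\<^sup>2 + racah_B\<^sup>2
     + racah_scale (1 / 2)
         ((racah_delta + 2) * anticommutator racah_A racah_B
          - anticommutator (racah_A\<^sup>2) racah_B - anticommutator racah_A (racah_B\<^sup>2))
     + racah_A * (racah_beta - racah_delta) - racah_B * (racah_delta + racah_alpha)"

definition casimir_class :: "'a::field racah set" where
  "casimir_class = {racah_Omega + c | c. c \<in> racah_frakC}"


section \<open>The dihedral group and its action\<close>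

text \<open>The pair \<open>(s, i)\<close> stands for \<open>\<sigma>\<^sup>s \<tau>\<^sup>i\<close>, with \<open>i\<close> an integer modulo 6; the product uses
  \<open>\<tau>\<^sup>i \<sigma> = \<sigma> \<tau>\<^sup>-\<^sup>i\<close>.\<close>

definition D6 :: "(bool \<times> 6) monoid" where
  "D6 = \<lparr>carrier = UNIV,
         mult = (\<lambda>(s, i) (t, j). (s \<noteq> t, (if t then - i else i) + j)),
         one = (False, 0)\<rparr>"

definition D6_sigma :: "bool \<times> 6" where "D6_sigma = (True, 0)"
definition D6_tau :: "bool \<times> 6" where "D6_tau = (False, 1)"

lemma D6_carrier: "x \<in> carrier D6"
  by (simp add: D6_def)

lemma group_D6: "group D6"
proof (rule groupI)
  fix x assume "x \<in> carrier D6"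
  show "\<exists>y\<in>carrier D6. y \<otimes>\<^bsub>D6\<^esub> x = \<one>\<^bsub>D6\<^esub>"
    by (rule bexI[of _ "(fst x, if fst x then snd x else - snd x)"])
      (auto simp: D6_def split: prod.splits)
qed (auto simp: D6_def split: prod.splits)

lemma D6_relations:
  "D6_sigma [^]\<^bsub>D6\<^esub> (2::nat) = \<one>\<^bsub>D6\<^esub>" "D6_tau [^]\<^bsub>D6\<^esub> (6::nat) = \<one>\<^bsub>D6\<^esub>"
  "(D6_sigma \<otimes>\<^bsub>D6\<^esub> D6_tau) [^]\<^bsub>D6\<^esub> (2::nat) = \<one>\<^bsub>D6\<^esub>"
  by (simp_all add: numeral_eq_Suc D6_sigma_def D6_tau_def D6_def nat_pow_def)

lemma D6_tau_pow: "D6_tau [^]\<^bsub>D6\<^esub> (n::nat) = (False, of_nat n)"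
  by (induction n) (simp_all add: D6_tau_def D6_def add.commute)

lemma D6_elements: "(b, i) = (if b then D6_sigma else \<one>\<^bsub>D6\<^esub>) \<otimes>\<^bsub>D6\<^esub> D6_tau [^]\<^bsub>D6\<^esub> nat (Rep_bit0 i)"
proof -
  have "0 \<le> Rep_bit0 i" using Rep_bit0[of i] by simp
  moreover have "of_int (Rep_bit0 i) = i" 
    using Rep_bit0[of i] by (simp add: bit0.of_int_eq Rep_bit0_inverse)
  ultimately have "of_nat (nat (Rep_bit0 i)) = i" by (simp add: of_nat_nat)
  then show ?thesis unfolding D6_tau_pow by (simp add: D6_def D6_sigma_def)
qed

lemma D6_universal:
  assumes "group G" and s: "s \<in> carrier G" and t: "t \<in> carrier G"
    and ss: "s [^]\<^bsub>G\<^esub> (2::nat) = \<one>\<^bsub>G\<^esub>" and tt: "t [^]\<^bsub>G\<^esub> (6::nat) = \<one>\<^bsub>G\<^esub>"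
    and st: "(s \<otimes>\<^bsub>G\<^esub> t) [^]\<^bsub>G\<^esub> (2::nat) = \<one>\<^bsub>G\<^esub>"
  shows "\<exists>!h. h \<in> hom D6 G \<and> h D6_sigma = s \<and> h D6_tau = t"
proof -
  interpret group G by fact
  define r where "r i = t [^]\<^bsub>G\<^esub> nat (Rep_bit0 i)" for i :: 6
  define h where "h = (\<lambda>(b, i). (if b then s else \<one>\<^bsub>G\<^esub>) \<otimes>\<^bsub>G\<^esub> r i)"
  have r_closed [simp]: "r i \<in> carrier G" for i
    using t by (simp add: r_def)
  have pow_mod: "t [^]\<^bsub>G\<^esub> (n mod 6) = t [^]\<^bsub>G\<^esub> n" for n :: nat
  proof -
    have "t [^]\<^bsub>G\<^esub> n = t [^]\<^bsub>G\<^esub> (6 * (n div 6) + n mod 6)" by simp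
    also have "\<dots> = (t [^]\<^bsub>G\<^esub> (6::nat)) [^]\<^bsub>G\<^esub> (n div 6) \<otimes>\<^bsub>G\<^esub> t [^]\<^bsub>G\<^esub> (n mod 6)"
      using t by (simp only: nat_pow_mult nat_pow_pow nat_pow_closed)
    finally show ?thesis using t by (simp add: tt)
  qed
  have Rep_add: "nat (Rep_bit0 (i + j)) = (nat (Rep_bit0 i) + nat (Rep_bit0 j)) mod 6" for i j :: 6
  proof -
    have "Rep_bit0 (i + j) = (Rep_bit0 i + Rep_bit0 j) mod 6"
      by (simp add: bit0.add_def Abs_bit0_inverse)
    then show ?thesis
      using Rep_bit0[of i] Rep_bit0[of j] by (simp add: nat_mod_distrib nat_add_distrib)
  qed
  have r_add: "r (i + j) = r i \<otimes>\<^bsub>G\<^esub> r j" for i j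
    using t by (simp add: r_def Rep_add pow_mod nat_pow_mult)
  have r0: "r 0 = \<one>\<^bsub>G\<^esub>" by (simp add: r_def bit0.Rep_0)
  have r1: "r 1 = t" using t by (simp add: r_def bit0.Rep_1)
  have r_minus: "r (- i) = inv\<^bsub>G\<^esub> r i" for i
    using r_add[of "- i" i] by (simp add: r0 inv_equality)
  have s2: "s \<otimes>\<^bsub>G\<^esub> s = \<one>\<^bsub>G\<^esub>" using ss s by (simp add: numeral_2_eq_2)
  have sts: "s \<otimes>\<^bsub>G\<^esub> t \<otimes>\<^bsub>G\<^esub> s = inv\<^bsub>G\<^esub> t"
    using st s t by (intro inv_equality[symmetric]) (simp_all add: numeral_2_eq_2 m_assoc)
  have ts: "t \<otimes>\<^bsub>G\<^esub> s = s \<otimes>\<^bsub>G\<^esub> inv\<^bsub>G\<^esub> t"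
  proof -
    have "s \<otimes>\<^bsub>G\<^esub> inv\<^bsub>G\<^esub> t = (s \<otimes>\<^bsub>G\<^esub> s) \<otimes>\<^bsub>G\<^esub> (t \<otimes>\<^bsub>G\<^esub> s)"
      using s t by (simp add: sts[symmetric] m_assoc)
    then show ?thesis using s t by (simp add: s2)
  qed
  have pow_s: "t [^]\<^bsub>G\<^esub> n \<otimes>\<^bsub>G\<^esub> s = s \<otimes>\<^bsub>G\<^esub> inv\<^bsub>G\<^esub> (t [^]\<^bsub>G\<^esub> n)" for n :: nat
  proof (induction n)
    case 0 then show ?case using s by simp
  next
    case (Suc n)
    have "t [^]\<^bsub>G\<^esub> Suc n \<otimes>\<^bsub>G\<^esub> s = t [^]\<^bsub>G\<^esub> n \<otimes>\<^bsub>G\<^esub> (t \<otimes>\<^bsub>G\<^esub> s)"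
      using s t by (simp add: m_assoc)
    also have "\<dots> = (t [^]\<^bsub>G\<^esub> n \<otimes>\<^bsub>G\<^esub> s) \<otimes>\<^bsub>G\<^esub> inv\<^bsub>G\<^esub> t"
      using s t by (simp add: ts m_assoc)
    also have "\<dots> = s \<otimes>\<^bsub>G\<^esub> inv\<^bsub>G\<^esub> (t \<otimes>\<^bsub>G\<^esub> t [^]\<^bsub>G\<^esub> n)"
      using s t by (simp add: Suc.IH m_assoc inv_mult_group)
    also have "t \<otimes>\<^bsub>G\<^esub> t [^]\<^bsub>G\<^esub> n = t [^]\<^bsub>G\<^esub> Suc n"
      using t by (rule nat_pow_Suc2[symmetric])
    finally show ?case .
  qed
  have r_s: "r i \<otimes>\<^bsub>G\<^esub> s = s \<otimes>\<^bsub>G\<^esub> r (- i)" for i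
    unfolding r_minus unfolding r_def by (rule pow_s)
  have r_s': "r i \<otimes>\<^bsub>G\<^esub> (s \<otimes>\<^bsub>G\<^esub> x) = s \<otimes>\<^bsub>G\<^esub> (r (- i) \<otimes>\<^bsub>G\<^esub> x)" if "x \<in> carrier G" for i x
    using r_s[of i] s that by (simp flip: m_assoc)
  have s2': "s \<otimes>\<^bsub>G\<^esub> (s \<otimes>\<^bsub>G\<^esub> x) = x" if "x \<in> carrier G" for x
    using s that by (simp add: s2 flip: m_assoc)
  have "h (x \<otimes>\<^bsub>D6\<^esub> y) = h x \<otimes>\<^bsub>G\<^esub> h y" for x y
    using s by (cases x; cases y)
      (simp add: h_def D6_def r_s' s2' m_assoc r_add)
  then have "h \<in> hom D6 G"
    using s by (auto simp: hom_def h_def split: prod.splits)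
  moreover have "h D6_sigma = s" "h D6_tau = t"
    using s t by (simp_all add: h_def D6_sigma_def D6_tau_def r0 r1)
  ultimately have ex: "h \<in> hom D6 G \<and> h D6_sigma = s \<and> h D6_tau = t" by blast
  have uniq: "f x = h x" if f: "f \<in> hom D6 G" "f D6_sigma = s" "f D6_tau = t" for f x
  proof -
    interpret f: group_hom D6 G f
      using f group_D6 by (simp add: group_hom_def group_hom_axioms_def is_group)
    obtain b i where x: "x = (b, i)" by (cases x)
    have "f x = (if b then s else \<one>\<^bsub>G\<^esub>) \<otimes>\<^bsub>G\<^esub> r i"
      unfolding x r_def by (subst D6_elements) (simp add: D6_carrier f.hom_nat_pow f)
    then show ?thesis by (simp add: x h_def)
  qed
  show ?thesis
  proof (rule ex1I[of _ h])
    show "f = h" if "f \<in> hom D6 G \<and> f D6_sigma = s \<and> f D6_tau = t" for f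
      using that by (intro ext uniq) blast+
  qed (fact ex)
qed

definition racah_antiautomorphism :: "('a::field racah \<Rightarrow> 'a racah) \<Rightarrow> bool" where
  "racah_antiautomorphism f \<longleftrightarrow>
     Vector_Spaces.linear racah_scale racah_scale f \<and> bij f \<and> f 1 = 1 \<and>
     (\<forall>x y. f (x * y) = f y * f x)"

definition is_racah_D6_action :: "(bool \<times> 6 \<Rightarrow> 'a::field racah \<Rightarrow> 'a racah) \<Rightarrow> bool" where
  "is_racah_D6_action \<phi> \<longleftrightarrow>
     group_action D6 UNIV \<phi> \<and>
     racah_antiautomorphism (\<phi> D6_sigma) \<and>
     \<phi> D6_sigma racah_A = racah_B \<and>
     \<phi> D6_sigma racah_B = racah_A \<and>
     \<phi> D6_sigma racah_C = racah_C \<and>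
     \<phi> D6_sigma racah_D = racah_D \<and>
     \<phi> D6_sigma racah_alpha = - racah_beta \<and>
     \<phi> D6_sigma racah_beta = - racah_alpha \<and>
     \<phi> D6_sigma racah_gamma = - racah_gamma \<and>
     \<phi> D6_sigma racah_delta = racah_delta \<and>
     racah_antiautomorphism (\<phi> D6_tau) \<and>
     \<phi> D6_tau racah_A = racah_B \<and>
     \<phi> D6_tau racah_B = racah_C \<and>
     \<phi> D6_tau racah_C = racah_A \<and>
     \<phi> D6_tau racah_D = - racah_D \<and>
     \<phi> D6_tau racah_alpha = racah_beta \<and>
     \<phi> D6_tau racah_beta = racah_gamma \<and>
     \<phi> D6_tau racah_gamma = racah_alpha \<and>
     \<phi> D6_tau racah_delta = racah_delta"

lemma racah_reorder:
  "racah_B * racah_A = racah_A * racah_B - 2 * (racah_D :: 'a::field racah)"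
  "racah_C * racah_B = racah_B * racah_C - 2 * (racah_D :: 'a racah)"
  "racah_C * racah_A = racah_A * racah_C + 2 * (racah_D :: 'a racah)"
  using racah_AB[where 'a='a] racah_BC[where 'a='a] racah_CA[where 'a='a]
  by (simp_all add: algebra_simps)

lemma racah_antihom_unique:
  fixes f g :: "'a::field racah \<Rightarrow> 'a racah"
  assumes f: "racah_antiautomorphism f" and g: "racah_antiautomorphism g"
    and gens: "f racah_A = g racah_A" "f racah_B = g racah_B" "f racah_C = g racah_C"
      "f racah_D = g racah_D"
  shows "f = g"
proof
  fix x
  interpret f: Vector_Spaces.linear racah_scale racah_scale f
    using f by (simp add: racah_antiautomorphism_def)
  interpret g: Vector_Spaces.linear racah_scale racah_scale g
    using g by (simp add: racah_antiautomorphism_def)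
  show "f x = g x"
  proof (induction x rule: racah_induct)
    case (const k)
    have "f (racah_scale k 1) = g (racah_scale k 1)"
      using f g by (simp add: f.scale g.scale racah_antiautomorphism_def)
    then show ?case by (simp add: racah_scale_def)
  qed (use f g in \<open>simp_all add: gens f.add g.add racah_antiautomorphism_def\<close>)
qed

lemma racah_antiautomorphism_exists:
  fixes a b c d :: "'a::field racah"
  assumes "racah_model racah_const (\<lambda>x y. y * x) a b c d"
  obtains f where "\<And>x y. f (x + y) = f x + f y" "\<And>x y. f (x * y) = f y * f x"
    "\<And>k. f (racah_const k) = racah_const k"
    "f racah_A = a" "f racah_B = b" "f racah_C = c" "f racah_D = d"
  using racah_model.racah_extension[OF assms] by blast

lemma racah_antiautomorphismI:
  assumes "\<And>x y. f (x + y) = f x + f y" "\<And>x y. f (x * y) = f y * f x"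
    "\<And>k. f (racah_const k) = racah_const k" "bij f"
  shows "racah_antiautomorphism f"
  unfolding racah_antiautomorphism_def
proof (intro conjI allI)
  show "Vector_Spaces.linear racah_scale racah_scale f"
    by unfold_locales (simp_all add: assms racah_scale_def racah_const_central)
  show "f 1 = 1" using assms(3)[of 1] by (simp add: racah_const_one)
qed (use assms in auto)

lemma racah_D6_action_ex1: "\<exists>!\<phi> :: bool \<times> 6 \<Rightarrow> 'a::field racah \<Rightarrow> _. is_racah_D6_action \<phi>"
proof (rule ex_ex1I)
  have racah_const_mult': "racah_const (k * l) = racah_const l * racah_const k" for k l :: 'a
    by (metis racah_const_mult mult.commute)
  have racah_const_central': "x * racah_const k = racah_const k * x \<longleftrightarrow> True" for k and x :: "'a racah"
    by (simp add: racah_const_central[of k x])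
  have m: "racah_model racah_const (\<lambda>x y. y * x) racah_B racah_A racah_C (racah_D :: 'a racah)"
  proof unfold_locales
    fix x :: "'a racah"
    note * = racah_beta_central[of x] racah_alpha_central[of x] racah_gamma_central[of x]
    show "x * (racah_D * racah_B - racah_B * racah_D + racah_C * racah_B - racah_B * racah_A) =
      (racah_D * racah_B - racah_B * racah_D + racah_C * racah_B - racah_B * racah_A) * x"
      using *(1) by (simp add: racah_beta_def algebra_simps)
    show "x * (racah_D * racah_A - racah_A * racah_D + racah_B * racah_A - racah_A * racah_C) =
      (racah_D * racah_A - racah_A * racah_D + racah_B * racah_A - racah_A * racah_C) * x"
      using *(2) by (simp add: racah_alpha_def algebra_simps)
    show "x * (racah_D * racah_C - racah_C * racah_D + racah_A * racah_C - racah_C * racah_B) =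
      (racah_D * racah_C - racah_C * racah_D + racah_A * racah_C - racah_C * racah_B) * x"
      using *(3) by (simp add: racah_gamma_def algebra_simps)
  qed (simp_all add: racah_const_add racah_const_mult' racah_const_one racah_const_central'
      racah_reorder mult_2 distrib_left distrib_right mult.assoc)
  obtain S where S: "\<And>x y. S (x + y) = S x + S y" "\<And>x y. S (x * y) = S y * S x"
    "\<And>k. S (racah_const k) = racah_const k"
    "S racah_A = racah_B" "S racah_B = racah_A" "S racah_C = racah_C"
    "S racah_D = (racah_D :: 'a racah)"
    using racah_antiautomorphism_exists[OF m] by blast
  have eqs: "racah_beta = racah_B * racah_D - racah_D * racah_B + racah_A * racah_B - racah_B * racah_C"
    "racah_gamma = racah_C * racah_D - racah_D * racah_C + racah_B * racah_C - racah_C * racah_A"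
    "racah_alpha = racah_A * racah_D - racah_D * racah_A + racah_C * racah_A - racah_A * (racah_B :: 'a racah)"
    by (simp_all add: racah_alpha_def racah_beta_def racah_gamma_def racah_reorder algebra_simps)
  have m': "racah_model racah_const (\<lambda>x y. y * x) racah_B racah_C racah_A (- racah_D :: 'a racah)"
  proof unfold_locales
    fix x :: "'a racah"
    show "x * (- racah_D * racah_B - racah_B * - racah_D + racah_A * racah_B - racah_B * racah_C) =
      (- racah_D * racah_B - racah_B * - racah_D + racah_A * racah_B - racah_B * racah_C) * x"
      using racah_beta_central[of x] by (simp add: eqs)
    show "x * (- racah_D * racah_C - racah_C * - racah_D + racah_B * racah_C - racah_C * racah_A) =
      (- racah_D * racah_C - racah_C * - racah_D + racah_B * racah_C - racah_C * racah_A) * x"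
      using racah_gamma_central[of x] by (simp add: eqs)
    show "x * (- racah_D * racah_A - racah_A * - racah_D + racah_C * racah_A - racah_A * racah_B) =
      (- racah_D * racah_A - racah_A * - racah_D + racah_C * racah_A - racah_A * racah_B) * x"
      using racah_alpha_central[of x] by (simp add: eqs)
  qed (simp_all add: racah_const_add racah_const_mult' racah_const_one racah_const_central'
      racah_reorder mult_2 distrib_left distrib_right mult.assoc)
  obtain T where T: "\<And>x y. T (x + y) = T x + T y" "\<And>x y. T (x * y) = T y * T x"
    "\<And>k. T (racah_const k) = racah_const k"
    "T racah_A = racah_B" "T racah_B = racah_C" "T racah_C = racah_A"
    "T racah_D = (- racah_D :: 'a racah)"
    using racah_antiautomorphism_exists[OF m'] by blast
  have T_uminus: "T (- x) = - T x" for x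
    using T(1)[of x "- x"] T(1)[of 0 0] by (simp add: eq_neg_iff_add_eq_0 add.commute)
  have T2: "T 2 = 2"
    using T(3)[of 2] by (simp add: racah_const_two)
  have S_uminus: "S (- x) = - S x" for x
    using S(1)[of x "- x"] S(1)[of 0 0] by (simp add: eq_neg_iff_add_eq_0 add.commute)
  have T_diff: "T (x - y) = T x - T y" for x y
    using T(1)[of x "- y"] by (simp add: T_uminus)
  have S_diff: "S (x - y) = S x - S y" for x y
    using S(1)[of x "- y"] by (simp add: S_uminus)
  have SS: "S (S x) = x" for x
    by (induction x rule: racah_induct) (simp_all add: S)
  have T6: "T (T (T (T (T (T x))))) = x" for x
    by (induction x rule: racah_induct) (simp_all add: T T_uminus)
  have ST: "S (T (S (T x))) = x" for x
    by (induction x rule: racah_induct) (simp_all add: S T T_uminus S_uminus)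
  have bij: "bij S" "bij T"
    by (rule o_bij[of S S], simp_all add: SS fun_eq_iff)
      (rule o_bij[of "\<lambda>x. T (T (T (T (T x))))" T], simp_all add: T6 fun_eq_iff)
  have anti: "racah_antiautomorphism S" "racah_antiautomorphism T"
    using S T bij by (auto intro: racah_antiautomorphismI)
  have Bij: "S \<in> Bij UNIV" "T \<in> Bij UNIV" "S \<circ> T \<in> Bij UNIV"
    using bij by (simp_all add: Bij_def bij_comp)
  have *: "f \<otimes>\<^bsub>BijGroup UNIV\<^esub> g = f \<circ> g" if "f \<in> Bij UNIV" "g \<in> Bij UNIV"
    for f g :: "'a racah \<Rightarrow> 'a racah"
    using that by (simp add: BijGroup_def compose_def restrict_def o_def)
  have one: "\<one>\<^bsub>BijGroup UNIV\<^esub> = (\<lambda>x :: 'a racah. x)"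
    by (simp add: BijGroup_def restrict_def)
  interpret BG: group "BijGroup (UNIV :: 'a racah set)" by (rule group_BijGroup)
  have pow: "f [^]\<^bsub>BijGroup UNIV\<^esub> n = f ^^ n" if "f \<in> Bij UNIV" for f :: "'a racah \<Rightarrow> 'a racah" and n
  proof (induction n)
    case 0 then show ?case by (simp add: one id_def)
  next
    case (Suc n)
    have "f ^^ n \<in> Bij UNIV" using that by (simp add: Bij_def)
    then show ?case using that by (simp add: Suc * funpow_swap1 fun_eq_iff)
  qed
  have "\<exists>!h. h \<in> hom D6 (BijGroup UNIV) \<and> h D6_sigma = S \<and> h D6_tau = T"
  proof (rule D6_universal)
    show "S [^]\<^bsub>BijGroup UNIV\<^esub> (2::nat) = \<one>\<^bsub>BijGroup UNIV\<^esub>"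
      unfolding pow[OF Bij(1)] by (simp add: SS fun_eq_iff numeral_eq_Suc one)
    show "T [^]\<^bsub>BijGroup UNIV\<^esub> (6::nat) = \<one>\<^bsub>BijGroup UNIV\<^esub>"
      unfolding pow[OF Bij(2)] by (simp add: T6 fun_eq_iff numeral_eq_Suc one)
    show "(S \<otimes>\<^bsub>BijGroup UNIV\<^esub> T) [^]\<^bsub>BijGroup UNIV\<^esub> (2::nat) = \<one>\<^bsub>BijGroup UNIV\<^esub>"
      unfolding *[OF Bij(1,2)] pow[OF Bij(3)] by (simp add: ST fun_eq_iff numeral_eq_Suc one)
  qed (use Bij group_BijGroup in \<open>auto simp: BijGroup_def\<close>)
  then obtain h where h: "h \<in> hom D6 (BijGroup UNIV)" "h D6_sigma = S" "h D6_tau = T" by blast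
  have "group_action D6 UNIV h"
    using h group_D6 by (simp add: group_action_def group_hom_def group_hom_axioms_def group_BijGroup)
  moreover have "S racah_alpha = - racah_beta" "S racah_beta = - racah_alpha"
      "S racah_gamma = - racah_gamma" "S racah_delta = racah_delta"
    by (simp_all add: racah_alpha_def racah_beta_def racah_gamma_def racah_delta_def S S_diff)
  moreover have "T racah_alpha = racah_beta" "T racah_beta = racah_gamma"
      "T racah_gamma = racah_alpha" "T racah_delta = racah_delta"
    by (simp_all add: eqs, simp_all add: T T2 T_diff racah_delta_def racah_reorder mult_2 mult_2_right algebra_simps)
  ultimately have "is_racah_D6_action h"
    unfolding is_racah_D6_action_def h(2,3) using anti S(4-7) T(4-7) by blast
  then show "\<exists>\<phi> :: bool \<times> 6 \<Rightarrow> 'a racah \<Rightarrow> _. is_racah_D6_action \<phi>" by blast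
next
  fix \<phi> \<psi> :: "bool \<times> 6 \<Rightarrow> 'a racah \<Rightarrow> 'a racah"
  assume a: "is_racah_D6_action \<phi>" "is_racah_D6_action \<psi>"
  have \<sigma>: "\<phi> D6_sigma = \<psi> D6_sigma" and \<tau>: "\<phi> D6_tau = \<psi> D6_tau"
    using a by (auto simp: is_racah_D6_action_def intro!: racah_antihom_unique)
  interpret f: group_hom D6 "BijGroup UNIV" \<phi>
    using a by (simp add: is_racah_D6_action_def group_action_def)
  interpret g: group_hom D6 "BijGroup UNIV" \<psi>
    using a by (simp add: is_racah_D6_action_def group_action_def)
  have "\<phi> (b, i) = \<psi> (b, i)" for b i
    by (subst (1 2) D6_elements) (simp add: D6_carrier f.hom_nat_pow g.hom_nat_pow \<sigma> \<tau>)
  then show "\<phi> = \<psi>" by auto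
qed

definition racah_D6_action :: "bool \<times> 6 \<Rightarrow> 'a::field racah \<Rightarrow> 'a racah" where
  "racah_D6_action = (THE \<phi>. is_racah_D6_action \<phi>)"

lemma is_racah_D6_action_racah_D6_action: "is_racah_D6_action racah_D6_action"
  unfolding racah_D6_action_def by (rule theI'[OF racah_D6_action_ex1])

end

theory Submission
  imports Defs
begin

text \<open>For \<open>char F \<noteq> 2\<close> the element \<open>\<delta>\<close> is central and \<open>\<alpha> + \<beta> + \<gamma> = [\<delta>, D] = 0\<close>. Substituting
  \<open>C = \<delta> - A - B\<close>, a direct computation shows that \<open>\<sigma>\<close> fixes the chosen representative \<open>\<Omega>\<close> of the
  Casimir class and that \<open>\<tau> \<Omega> = \<Omega> - (\<delta> + 1) \<beta>\<close>. Both maps permute the generators of the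
  subalgebra \<open>\<CC>\<close> up to sign, so they map \<open>\<Omega> + \<CC>\<close> into itself, and \<open>\<sigma>, \<tau>\<close> generate the group.\<close>

section \<open>Halving in characteristic other than two\<close>

lemma CHAR_neq_2_imp_two_neq_0:
  assumes "CHAR('a::field) \<noteq> 2"
  shows "(2::'a) \<noteq> 0"
proof
  assume "(2::'a) = 0"
  then have "of_nat 2 = (0::'a)" by simp
  then have "CHAR('a) dvd 2" by (simp only: of_nat_eq_0_iff_char_dvd)
  then have "CHAR('a) \<le> 2" "CHAR('a) \<noteq> 0" by (auto dest: dvd_imp_le intro: gr0I)
  moreover have "CHAR('a) \<noteq> 1" by simp
  ultimately show False using assms by linarith
qed

lemma racah_scale_half_double:
  assumes "(2::'a::field) \<noteq> 0"
  shows "racah_scale (1 / 2 :: 'a) (2 * x) = x"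
proof -
  have "racah_scale (1 / 2) (2 * x) = racah_scale (1 / 2) (racah_scale 2 x)"
    by (simp add: racah_scale_def racah_const_two)
  then show ?thesis using assms by simp
qed

lemma racah_double_cancel:
  fixes x y :: "'a::field racah"
  assumes "(2::'a) \<noteq> 0" and "2 * x = 2 * y"
  shows "x = y"
  using racah_scale_half_double[OF assms(1)] assms(2) by metis

section \<open>Commutation of \<delta> and the relation between \<alpha>, \<beta>, \<gamma>\<close>

lemma racah_delta_commutes_A: "racah_A * racah_delta = racah_delta * racah_A"
  by (simp add: racah_delta_def racah_reorder algebra_simps)

lemma racah_delta_commutes_B: "racah_B * racah_delta = racah_delta * racah_B"
  by (simp add: racah_delta_def racah_reorder algebra_simps)

lemma racah_delta_left_commutes:
  "racah_A * (racah_delta * x) = racah_delta * (racah_A * x)"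
  "racah_B * (racah_delta * x) = racah_delta * (racah_B * x)"
  by (simp_all add: racah_delta_commutes_A racah_delta_commutes_B flip: mult.assoc)

lemmas racah_delta_commutes = racah_delta_commutes_A racah_delta_commutes_B racah_delta_left_commutes

text \<open>Commuting with A and B, \<delta> commutes with [A,B] = 2D; halving passes from 2D to
  D.\<close>

lemma racah_delta_commutes_D:
  assumes "(2::'a::field) \<noteq> 0"
  shows "racah_D * racah_delta = racah_delta * (racah_D :: 'a racah)"
proof (rule racah_double_cancel[OF assms])
  let ?A = "racah_A :: 'a racah" and ?B = "racah_B :: 'a racah" and ?d = "racah_delta :: 'a racah"
  have "(?A * ?B - ?B * ?A) * ?d = ?d * (?A * ?B - ?B * ?A)"
    by (simp add: racah_delta_commutes algebra_simps)
  then show "2 * (racah_D * ?d) = 2 * (?d * racah_D)"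
    unfolding racah_AB by (simp add: mult_2 distrib_left distrib_right)
qed

text \<open>The quadratic terms AC, BA, CB cancel in the sum, which leaves [\<delta>,D].\<close>

lemma racah_alpha_beta_gamma:
  assumes "(2::'a::field) \<noteq> 0"
  shows "racah_alpha + racah_beta + racah_gamma = (0 :: 'a racah)"
proof -
  have "racah_alpha + racah_beta + racah_gamma = racah_delta * racah_D - racah_D * (racah_delta :: 'a racah)"
    by (simp add: racah_alpha_def racah_beta_def racah_gamma_def racah_delta_def algebra_simps)
  then show ?thesis using racah_delta_commutes_D[OF assms] by simp
qed

section \<open>The halved part of the Casimir representative and its rotation\<close>

definition casimir_cubic :: "'b::ring_1 \<Rightarrow> 'b \<Rightarrow> 'b \<Rightarrow> 'b" where
  "casimir_cubic e a b =
     (e + 2) * anticommutator a b - anticommutator (a\<^sup>2) b - anticommutator a (b\<^sup>2)"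

lemma casimir_cubic_commute: "casimir_cubic e b a = casimir_cubic e a b"
  by (simp add: casimir_cubic_def anticommutator_def algebra_simps)

text \<open>Made for the step from the pair A, B to the pair B, C = \<delta> - A - B. The change is
  displayed as a multiple of 2 so that the scalar 1/2 in \<open>racah_Omega\<close> cancels against
  it.\<close>

lemma casimir_cubic_shift:
  fixes a b d e :: "'b::ring_1"
  assumes ae: "a * e = e * a" and be: "b * e = e * b" and ab: "a * b - b * a = 2 * d"
  shows "casimir_cubic e b (e - a - b) = casimir_cubic e a b
    + 2 * (2 * e * b - 2 * anticommutator a b - 2 * b\<^sup>2 + (d * b - b * d))"
proof -
  have ae': "a * (e * x) = e * (a * x)" and be': "b * (e * x) = e * (b * x)" for x
    using ae be by (simp_all flip: mult.assoc)
  \<comment> \<open>Trading 2[d,b] for [[a,b],b] eliminates d; a polynomial identity in a, b and the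
    commuting e remains.\<close>
  have db: "2 * (d * b - b * d) = (a * b - b * a) * b - b * (a * b - b * a)"
    by (simp add: ab mult_2 distrib_left distrib_right)
  show ?thesis
    unfolding distrib_left[of 2] db casimir_cubic_def anticommutator_def power2_eq_square
    by (simp add: ae be ae' be' mult_2 mult_2_right algebra_simps)
qed

lemma racah_Omega_eq:
  "racah_Omega = racah_D\<^sup>2 + racah_A\<^sup>2 + racah_B\<^sup>2
     + racah_scale (1 / 2) (casimir_cubic racah_delta racah_A racah_B)
     + racah_A * (racah_beta - racah_delta) - racah_B * (racah_delta + racah_alpha)"
  by (simp add: racah_Omega_def casimir_cubic_def)

lemma racah_C_eq: "racah_C = racah_delta - racah_A - racah_B"
  by (simp add: racah_delta_def)

text \<open>The left side is the image of \<open>racah_Omega\<close> under \<tau>. In the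
  correction, -\<delta>\<beta> comes from -C\<beta> with C = \<delta> - A - B, and -\<beta> from the
  commutator [D,B] left by the cubic shift.\<close>

lemma racah_Omega_rotate:
  assumes two: "(2::'a::field) \<noteq> 0"
  shows "racah_D\<^sup>2 + racah_B\<^sup>2 + racah_C\<^sup>2
     + racah_scale (1 / 2) (casimir_cubic racah_delta racah_B racah_C)
     + racah_B * (racah_gamma - racah_delta) - racah_C * (racah_delta + racah_beta)
   = racah_Omega - (racah_delta + 1) * (racah_beta :: 'a racah)"
proof -
  let ?A = "racah_A :: 'a racah" and ?B = "racah_B :: 'a racah" and ?D = "racah_D :: 'a racah"
    and ?e = "racah_delta :: 'a racah" and ?b = "racah_beta :: 'a racah"
  have g: "racah_gamma = - racah_alpha - ?b"
    using racah_alpha_beta_gamma[OF two] by (simp add: algebra_simps eq_neg_iff_add_eq_0)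
  have "?b = ?B * ?D - ?D * ?B + ?B * ?A - (?e - ?A - ?B) * ?B"
    by (simp add: racah_beta_def racah_C_eq)
  \<comment> \<open>The definition of \<beta>, solved for DB to serve as a rewrite rule that removes
    [D,B].\<close>
  then have DB: "?D * ?B = ?B * ?D + ?B * ?A - (?e - ?A - ?B) * ?B - ?b"
    by (simp add: algebra_simps)
  have cubic: "racah_scale (1 / 2) (casimir_cubic ?e ?B racah_C)
      = racah_scale (1 / 2) (casimir_cubic ?e ?A ?B)
        + (2 * ?e * ?B - 2 * anticommutator ?A ?B - 2 * ?B\<^sup>2 + (?D * ?B - ?B * ?D))"
    unfolding racah_C_eq
      casimir_cubic_shift[OF racah_delta_commutes_A racah_delta_commutes_B racah_AB]
      racah.scale_right_distrib racah_scale_half_double[OF two] ..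
  show ?thesis
    \<comment> \<open>\<open>cubic\<close> goes first, since its left side mentions
      \<open>racah_C\<close>, which \<open>racah_C_eq\<close> eliminates.\<close>
    unfolding cubic unfolding racah_Omega_eq anticommutator_def power2_eq_square DB g racah_C_eq
    by (simp add: racah_delta_commutes racah_alpha_central
        racah_beta_central[of ?B] mult_2 algebra_simps)
qed

section \<open>Images of the representative under \<sigma> and \<tau>\<close>

lemma racah_antiautomorphism_simps:
  assumes "racah_antiautomorphism f"
  shows "f (x + y) = f x + f y" "f (x - y) = f x - f y" "f (x * y) = f y * f x"
    "f (racah_scale k x) = racah_scale k (f x)" "f 1 = 1" "f 2 = 2"
    "f (x\<^sup>2) = (f x)\<^sup>2"
proof -
  interpret f: Vector_Spaces.linear racah_scale racah_scale f
    using assms by (simp add: racah_antiautomorphism_def)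
  show "f (x + y) = f x + f y" "f (x - y) = f x - f y" "f (racah_scale k x) = racah_scale k (f x)"
    by (simp_all add: f.add f.diff f.scale)
  show "f (x * y) = f y * f x" "f 1 = 1" "f (x\<^sup>2) = (f x)\<^sup>2"
    using assms by (simp_all add: racah_antiautomorphism_def power2_eq_square)
  show "f 2 = 2" using f.add[of 1 1] \<open>f 1 = 1\<close> by simp
qed

text \<open>Reversing products only swaps the two summands of each anticommutator; the factor e + 2
  lands on the right and is moved back by the commutation hypotheses.\<close>

lemma antiautomorphism_casimir_cubic:
  assumes "racah_antiautomorphism f" and "f e = e" "f a * e = e * f a" "f b * e = e * f b"
  shows "f (casimir_cubic e a b) = casimir_cubic e (f a) (f b)"
proof -
  have "f a * (f b * e) = e * (f a * f b)" "f b * (f a * e) = e * (f b * f a)"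
    using assms(3,4) by (metis mult.assoc)+
  then show ?thesis
    unfolding casimir_cubic_def anticommutator_def
    by (simp add: racah_antiautomorphism_simps[OF assms(1)] assms(2) mult_2 mult_2_right algebra_simps)
qed

text \<open>The cubic part is symmetric in A and B, and \<sigma> exchanges A(\<beta> - \<delta>)
  with -B(\<delta> + \<alpha>).\<close>

lemma sigma_Omega: "racah_D6_action D6_sigma racah_Omega = (racah_Omega :: 'a::field racah)"
proof -
  let ?f = "racah_D6_action D6_sigma :: 'a racah \<Rightarrow> 'a racah"
  have act: "is_racah_D6_action (racah_D6_action :: _ \<Rightarrow> 'a racah \<Rightarrow> _)"
    by (rule is_racah_D6_action_racah_D6_action)
  then have f: "racah_antiautomorphism ?f"
    and gens: "?f racah_A = racah_B" "?f racah_B = racah_A" "?f racah_D = racah_D"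
      "?f racah_alpha = - racah_beta" "?f racah_beta = - racah_alpha" "?f racah_delta = racah_delta"
    by (simp_all add: is_racah_D6_action_def)
  have "?f (casimir_cubic racah_delta racah_A racah_B) = casimir_cubic racah_delta racah_B racah_A"
    using antiautomorphism_casimir_cubic[OF f, of racah_delta racah_A racah_B]
    by (simp add: gens racah_delta_commutes_A racah_delta_commutes_B)
  then show ?thesis
    unfolding racah_Omega_eq
    by (simp add: racah_antiautomorphism_simps[OF f] gens casimir_cubic_commute[of _ racah_B]
        racah_delta_commutes_A racah_delta_commutes_B racah_alpha_central racah_beta_central
        algebra_simps)
qed

text \<open>Termwise, \<tau> produces the left side of \<open>racah_Omega_rotate\<close>; the sign
  in D \<mapsto> -D disappears in the square.\<close>

lemma tau_Omega:
  assumes "(2::'a::field) \<noteq> 0"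
  shows "racah_D6_action D6_tau racah_Omega = racah_Omega - (racah_delta + 1) * (racah_beta :: 'a racah)"
proof -
  let ?f = "racah_D6_action D6_tau :: 'a racah \<Rightarrow> 'a racah"
  have act: "is_racah_D6_action (racah_D6_action :: _ \<Rightarrow> 'a racah \<Rightarrow> _)"
    by (rule is_racah_D6_action_racah_D6_action)
  then have f: "racah_antiautomorphism ?f"
    and gens: "?f racah_A = racah_B" "?f racah_B = racah_C" "?f racah_D = - racah_D"
      "?f racah_alpha = racah_beta" "?f racah_beta = racah_gamma" "?f racah_delta = racah_delta"
    by (simp_all add: is_racah_D6_action_def)
  have C: "racah_C * racah_delta = racah_delta * (racah_C :: 'a racah)"
    by (simp add: racah_C_eq racah_delta_commutes_A racah_delta_commutes_B algebra_simps)
  have "?f (casimir_cubic racah_delta racah_A racah_B) = casimir_cubic racah_delta racah_B racah_C"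
    using antiautomorphism_casimir_cubic[OF f, of racah_delta racah_A racah_B]
    by (simp add: gens racah_delta_commutes_B C)
  then show ?thesis
    unfolding racah_Omega_rotate[OF assms, symmetric] unfolding racah_Omega_eq
    by (simp add: racah_antiautomorphism_simps[OF f] gens racah_delta_commutes_B C
        racah_beta_central racah_gamma_central algebra_simps)
qed

section \<open>Stability of the subalgebra and of its coset\<close>

lemma racah_frakC_generators:
  "racah_alpha \<in> racah_frakC" "racah_beta \<in> racah_frakC"
  "racah_gamma \<in> racah_frakC" "racah_delta \<in> racah_frakC"
  unfolding racah_frakC_def by (simp_all add: hull_inc)

lemma racah_frakC_closed:
  fixes x y :: "'a::field racah"
  shows "x \<in> racah_frakC \<Longrightarrow> y \<in> racah_frakC \<Longrightarrow> x + y \<in> racah_frakC"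
    and "x \<in> racah_frakC \<Longrightarrow> - x \<in> racah_frakC"
    and "x \<in> racah_frakC \<Longrightarrow> y \<in> racah_frakC \<Longrightarrow> x * y \<in> racah_frakC"
    and "0 \<in> (racah_frakC :: 'a racah set)" "1 \<in> (racah_frakC :: 'a racah set)"
  using racah_subalgebra_frakC[where 'a = 'a]
  by (auto simp: racah_subalgebra_def racah.subspace_add racah.subspace_neg racah.subspace_0)

text \<open>The preimage of \<open>racah_frakC\<close> under f is again a subalgebra, as reversing
  products does not affect closure. It contains the four generators, so minimality of the hull
  applies.\<close>

lemma antiautomorphism_frakC:
  assumes f: "racah_antiautomorphism f"
    and gens: "f racah_alpha \<in> racah_frakC" "f racah_beta \<in> racah_frakC"
      "f racah_gamma \<in> racah_frakC" "f racah_delta \<in> racah_frakC"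
    and x: "x \<in> racah_frakC"
  shows "f x \<in> racah_frakC"
proof -
  interpret f: Vector_Spaces.linear racah_scale racah_scale f
    using f by (simp add: racah_antiautomorphism_def)
  have "racah_subalgebra (f -` racah_frakC)"
    using racah_subalgebra_frakC
    by (auto simp: racah_subalgebra_def racah.subspace_def racah_antiautomorphism_simps[OF f] f.zero)
  then have "racah_frakC \<subseteq> f -` racah_frakC"
    unfolding racah_frakC_def using gens by (intro hull_minimal) (auto simp: racah_frakC_def)
  then show ?thesis using x by blast
qed

lemma antiautomorphism_casimir_class:
  assumes f: "racah_antiautomorphism f"
    and gens: "f racah_alpha \<in> racah_frakC" "f racah_beta \<in> racah_frakC"
      "f racah_gamma \<in> racah_frakC" "f racah_delta \<in> racah_frakC"
    and Omega: "f racah_Omega = racah_Omega + c" "c \<in> racah_frakC"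
    and x: "x \<in> casimir_class"
  shows "f x \<in> casimir_class"
proof -
  obtain y where y: "x = racah_Omega + y" "y \<in> racah_frakC"
    using x by (auto simp: casimir_class_def)
  have "f x = racah_Omega + (c + f y)"
    by (simp add: y racah_antiautomorphism_simps[OF f] Omega add.assoc)
  moreover have "c + f y \<in> racah_frakC"
    by (intro racah_frakC_closed(1) antiautomorphism_frakC[OF f gens] Omega y)
  ultimately show ?thesis unfolding casimir_class_def by blast
qed

lemma sigma_casimir_class:
  assumes "x \<in> (casimir_class :: 'a::field racah set)"
  shows "racah_D6_action D6_sigma x \<in> casimir_class"
  by (rule antiautomorphism_casimir_class[where f = "racah_D6_action D6_sigma" and c = 0])
    (use is_racah_D6_action_racah_D6_action[where 'a = 'a] assms in
      \<open>simp_all add: is_racah_D6_action_def sigma_Omega racah_frakC_generators racah_frakC_closed\<close>)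

lemma tau_casimir_class:
  assumes "(2::'a::field) \<noteq> 0" and "x \<in> (casimir_class :: 'a racah set)"
  shows "racah_D6_action D6_tau x \<in> casimir_class"
  by (rule antiautomorphism_casimir_class[where f = "racah_D6_action D6_tau"
      and c = "- ((racah_delta + 1) * racah_beta)"])
    (use is_racah_D6_action_racah_D6_action[where 'a = 'a] assms in
      \<open>simp_all add: is_racah_D6_action_def tau_Omega racah_frakC_generators racah_frakC_closed\<close>)

section \<open>From the two generators to the whole group\<close>

lemma D6_action_casimir_class:
  assumes two: "(2::'a::field) \<noteq> 0" and x: "x \<in> (casimir_class :: 'a racah set)"
  shows "racah_D6_action g x \<in> casimir_class"
proof -
  interpret group_action D6 UNIV "racah_D6_action :: _ \<Rightarrow> 'a racah \<Rightarrow> _"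
    using is_racah_D6_action_racah_D6_action[where 'a = 'a] by (simp add: is_racah_D6_action_def)
  interpret group D6 by (rule group_D6)
  have one: "racah_D6_action \<one>\<^bsub>D6\<^esub> y = y" for y :: "'a racah"
    using id_eq_one by (metis UNIV_I restrict_apply)
  have mult: "racah_D6_action (h \<otimes>\<^bsub>D6\<^esub> k) y = racah_D6_action h (racah_D6_action k y)"
    for h k and y :: "'a racah"
    by (rule composition_rule) (simp_all add: D6_carrier)
  have tau_pow: "racah_D6_action (D6_tau [^]\<^bsub>D6\<^esub> n) y \<in> casimir_class" if "y \<in> casimir_class"
    for n :: nat and y :: "'a racah"
    \<comment> \<open>The successor power splits off \<tau> on the right, so \<tau> acts first and
      the induction hypothesis is applied to the image of y.\<close>
    using that by (induction n arbitrary: y) (simp_all add: one mult tau_casimir_class[OF two])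
  \<comment> \<open>The normal form of g is a power of \<tau>, preceded by \<sigma> when b
    holds.\<close>
  obtain b i where "g = (b, i)" by (cases g)
  then show ?thesis
    by (subst D6_elements[of b i, folded \<open>g = (b, i)\<close>])
      (simp add: mult one tau_pow x sigma_casimir_class)
qed

theorem lemma6p6:
  fixes g :: "bool \<times> 6"
  assumes "CHAR('a::field) \<noteq> 2" and "g \<in> carrier D6"
  shows "racah_D6_action g ` (casimir_class :: 'a racah set) = casimir_class"
proof -
  interpret group_action D6 UNIV "racah_D6_action :: _ \<Rightarrow> 'a racah \<Rightarrow> _"
    using is_racah_D6_action_racah_D6_action[where 'a = 'a] by (simp add: is_racah_D6_action_def)
  note closed = D6_action_casimir_class[OF CHAR_neq_2_imp_two_neq_0[OF assms(1)]]
  \<comment> \<open>Stability under every group element includes the inverse of g, which supplies a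
    preimage of x inside the class; this upgrades inclusion to equality.\<close>
  have "x \<in> racah_D6_action g ` casimir_class" if "x \<in> casimir_class" for x :: "'a racah"
  proof
    show "x = racah_D6_action g (racah_D6_action (inv\<^bsub>D6\<^esub> g) x)"
      using orbit_sym_aux[of "inv\<^bsub>D6\<^esub> g" x] group.inv_inv[OF group_D6 assms(2)]
      by (simp add: D6_carrier)
  qed (rule closed[OF that])
  then show ?thesis using closed by blast
qed

end
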